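(* Let $\mathcal{E}\in\mathrm{End}(\mathbb{R}^7)$ and let $(\mathbb{R}^8,\mathcal{E})$ be the corresponding quasi abelian Lie algebra with its standard metric. If $\mathcal{E}$ is skew-symmetric, then $(\mathbb{R}^8,\mathcal{E})$ is flat. In particular, quasi abelian Lie algebras which admit an invariant parallel $\mathrm{Spin}(7)$ structure are flat.
   Context: $(\mathbb{R}^8,\mathcal{E})$ denotes the Lie algebra with underlying space $\mathbb{R}^8=\langle e_0,\dots,e_7\rangle$ in which $\mathbb{R}^7=\langle e_1,\dots,e_7\rangle$ is an abelian ideal and $\mathrm{ad}(e_0)|_{\mathbb{R}^7}=\mathcal{E}$, endowed with the canonical metric making $(e_0,\dots,e_7)$ orthonormal. A Lie algebra is quasi abelian if it has a codimension $1$ abelian ideal. A Lie algebra with a metric is called flat if the associated left-invariant metric on the simply connected Lie group has zero curvature. An invariant $\mathrm{Spin}(7)$ structure on an $8$-dimensional Lie algebra is a $4$-form $\Omega$ on it which in some basis has the form $e^{0123}-e^{0145}-e^{0167}-e^{0246}+e^{0257}-e^{0347}-e^{0356}+e^{4567}-e^{2367}-e^{2345}-e^{1357}+e^{1346}-e^{1256}-e^{1247}$, with the metric for which that basis is orthonormal; it is parallel if $d\Omega=0$ as a left-invariant form. In the second sentence, flatness refers to the metric of the $\mathrm{Spin}(7)$ structure. *)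

theory Defs
  imports "HOL-Analysis.Analysis" "HOL-Combinatorics.Permutations"
begin

section \<open>Real Lie algebras\<close>

definition lie_algebra :: "('v::real_vector \<Rightarrow> 'v \<Rightarrow> 'v) \<Rightarrow> bool" where
  "lie_algebra br \<longleftrightarrow>
     bilinear br \<and> (\<forall>x. br x x = 0) \<and>
     (\<forall>x y z. br x (br y z) + br y (br z x) + br z (br x y) = 0)"

definition abelian_ideal :: "('v::real_vector \<Rightarrow> 'v \<Rightarrow> 'v) \<Rightarrow> 'v set \<Rightarrow> bool" where
  "abelian_ideal br h \<longleftrightarrow>
     subspace h \<and> (\<forall>x. \<forall>y\<in>h. br x y \<in> h) \<and> (\<forall>x\<in>h. \<forall>y\<in>h. br x y = 0)"

definition quasi_abelian :: "('v::real_vector \<Rightarrow> 'v \<Rightarrow> 'v) \<Rightarrow> bool" where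
  "quasi_abelian br \<longleftrightarrow>
     lie_algebra br \<and> (\<exists>h. abelian_ideal br h \<and> dim h + 1 = dim (UNIV :: 'v set))"

text \<open>
  The Lie algebra \<open>(\<real>\<^sup>8, E)\<close>. Its space is written as the orthogonal sum \<open>\<real> \<times> \<real>\<^sup>7\<close>
  with \<open>e\<^sub>0 = (1, 0)\<close> and \<open>e\<^sub>i = (0, axis i 1)\<close>; the inner product of the product type is
  the one for which these vectors are orthonormal.
\<close>

definition ext_bracket ::
    "(real^7 \<Rightarrow> real^7) \<Rightarrow> real \<times> (real^7) \<Rightarrow> real \<times> (real^7) \<Rightarrow> real \<times> (real^7)" where
  "ext_bracket E u v = (0, fst u *\<^sub>R E (snd v) - fst v *\<^sub>R E (snd u))"

lemma ext_bracket_e0: "linear E \<Longrightarrow> ext_bracket E (1, 0) (0, x) = (0, E x)"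
  by (simp add: ext_bracket_def)

lemma ext_bracket_R7: "ext_bracket E (0, x) (0, y) = 0"
  by (simp add: ext_bracket_def zero_prod_def)

lemma lie_algebra_ext_bracket:
  assumes "linear E"
  shows "lie_algebra (ext_bracket E)"
  unfolding lie_algebra_def bilinear_def
  by (auto intro!: linearI simp: ext_bracket_def zero_prod_def algebra_simps
      linear_add[OF assms] linear_diff[OF assms] linear_cmul[OF assms] linear_0[OF assms])


section \<open>Left-invariant metrics and flatness\<close>

text \<open>
  A left-invariant metric on the simply connected Lie group is determined by an inner product
  on the Lie algebra. Its Levi-Civita connection and curvature are left-invariant, hence
  determined by their values on left-invariant vector fields, that is, on the Lie algebra. As
  the functions \<open>g (x, y)\<close> are then constant, compatibility with the metric reads
  \<open>g (D\<^sub>x y, z) + g (y, D\<^sub>x z) = 0\<close>.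
\<close>

definition inner_product :: "('v::real_vector \<Rightarrow> 'v \<Rightarrow> real) \<Rightarrow> bool" where
  "inner_product g \<longleftrightarrow>
     bilinear g \<and> (\<forall>x y. g x y = g y x) \<and> (\<forall>x. x \<noteq> 0 \<longrightarrow> g x x > 0)"

definition levi_civita ::
    "('v::real_vector \<Rightarrow> 'v \<Rightarrow> 'v) \<Rightarrow> ('v \<Rightarrow> 'v \<Rightarrow> real) \<Rightarrow> ('v \<Rightarrow> 'v \<Rightarrow> 'v) \<Rightarrow> bool" where
  "levi_civita br g D \<longleftrightarrow>
     bilinear D \<and> (\<forall>x y. D x y - D y x = br x y) \<and>
     (\<forall>x y z. g (D x y) z + g y (D x z) = 0)"

definition curvature ::
    "('v::real_vector \<Rightarrow> 'v \<Rightarrow> 'v) \<Rightarrow> ('v \<Rightarrow> 'v \<Rightarrow> 'v) \<Rightarrow> 'v \<Rightarrow> 'v \<Rightarrow> 'v \<Rightarrow> 'v" where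
  "curvature br D x y z = D x (D y z) - D y (D x z) - D (br x y) z"

text \<open>The connection in the following definition is unique, see \<open>levi_civita_unique\<close>.\<close>

definition flat :: "('v::real_vector \<Rightarrow> 'v \<Rightarrow> 'v) \<Rightarrow> ('v \<Rightarrow> 'v \<Rightarrow> real) \<Rightarrow> bool" where
  "flat br g \<longleftrightarrow> (\<exists>D. levi_civita br g D \<and> (\<forall>x y z. curvature br D x y z = 0))"

lemma levi_civita_unique:
  assumes g: "inner_product g" and D: "levi_civita br g D" and D': "levi_civita br g D'"
  shows "D = D'"
proof (intro ext)
  fix x y
  have bil: "bilinear g" and sym: "\<And>u v. g u v = g v u"
    and pos: "\<And>u. u \<noteq> 0 \<Longrightarrow> g u u > 0"
    using g by (auto simp: inner_product_def)
  define S where "S u v = D u v - D' u v" for u v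
  have tor: "D u v - D v u = D' u v - D' v u" for u v
    using D D' by (simp add: levi_civita_def)
  have S_sym: "S u v = S v u" for u v
    using tor[of u v] by (simp add: S_def algebra_simps)
  have S_skew: "g (S u v) w = - g (S u w) v" for u v w
  proof -
    have "g (D u v) w + g v (D u w) = 0" "g (D' u v) w + g v (D' u w) = 0"
      using D D' by (auto simp: levi_civita_def)
    moreover have "g (S u v) w = g (D u v) w - g (D' u v) w"
      "g (S u w) v = g (D u w) v - g (D' u w) v"
      by (simp_all add: S_def bilinear_lsub[OF bil])
    ultimately show ?thesis using sym by (smt (verit))
  qed
  have "g (S u v) w = 0" for u v w
    using S_skew[of u v w] S_skew[of w u v] S_skew[of v w u]
      S_sym[of u v] S_sym[of u w] S_sym[of v w] by simp
  then have "S x y = 0" using pos by fastforce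
  then show "D x y = D' x y" by (simp add: S_def)
qed


section \<open>Left-invariant forms\<close>

text \<open>
  A \<open>k\<close>-form is a function on lists of vectors, of which only the values on lists of length
  \<open>k\<close> are meaningful.
\<close>

definition wedge :: "('v \<Rightarrow> real) list \<Rightarrow> 'v list \<Rightarrow> real" where
  "wedge \<alpha>s vs = (\<Sum>p | p permutes {..<length \<alpha>s}.
     of_int (sign p) * (\<Prod>i<length \<alpha>s. (\<alpha>s ! i) (vs ! p i)))"

text \<open>
  The exterior derivative of left-invariant forms. The terms that differentiate the constants
  \<open>\<omega> (x\<^sub>0, \<dots>, x\<^sub>k)\<close> vanish, and \<open>nths xs (- {i, j})\<close> is \<open>xs\<close> without its entries \<open>i\<close> and \<open>j\<close>.
\<close>

definition ext_deriv ::
    "('v \<Rightarrow> 'v \<Rightarrow> 'v) \<Rightarrow> ('v list \<Rightarrow> real) \<Rightarrow> 'v list \<Rightarrow> real" where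
  "ext_deriv br \<omega> xs = (\<Sum>i<length xs. \<Sum>j\<in>{i<..<length xs}.
     (-1) ^ (i + j) * \<omega> (br (xs ! i) (xs ! j) # nths xs (- {i, j})))"

definition closed_form :: "('v \<Rightarrow> 'v \<Rightarrow> 'v) \<Rightarrow> nat \<Rightarrow> ('v list \<Rightarrow> real) \<Rightarrow> bool" where
  "closed_form br k \<omega> \<longleftrightarrow> (\<forall>xs. length xs = Suc k \<longrightarrow> ext_deriv br \<omega> xs = 0)"


section \<open>Spin(7) structures\<close>

definition basis8 :: "(nat \<Rightarrow> 'v::real_vector) \<Rightarrow> bool" where
  "basis8 e \<longleftrightarrow> inj_on e {..<8} \<and> independent (e ` {..<8}) \<and> span (e ` {..<8}) = UNIV"

definition dual8 :: "(nat \<Rightarrow> 'v::real_vector) \<Rightarrow> nat \<Rightarrow> 'v \<Rightarrow> real" where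
  "dual8 e i v = representation (e ` {..<8}) v (e i)"

definition spin7_form :: "(nat \<Rightarrow> 'v::real_vector) \<Rightarrow> 'v list \<Rightarrow> real" where
  "spin7_form e vs =
    (let w = (\<lambda>i j k l. wedge [dual8 e i, dual8 e j, dual8 e k, dual8 e l] vs)
     in w 0 1 2 3 - w 0 1 4 5 - w 0 1 6 7 - w 0 2 4 6 + w 0 2 5 7 - w 0 3 4 7 - w 0 3 5 6
      + w 4 5 6 7 - w 2 3 6 7 - w 2 3 4 5 - w 1 3 5 7 + w 1 3 4 6 - w 1 2 5 6 - w 1 2 4 7)"

definition spin7_structure ::
    "('v::real_vector list \<Rightarrow> real) \<Rightarrow> ('v \<Rightarrow> 'v \<Rightarrow> real) \<Rightarrow> bool" where
  "spin7_structure \<Omega> g \<longleftrightarrow>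
     (\<exists>e. basis8 e \<and> (\<forall>vs. length vs = 4 \<longrightarrow> \<Omega> vs = spin7_form e vs) \<and>
       inner_product g \<and> (\<forall>i<8. \<forall>j<8. g (e i) (e j) = (if i = j then 1 else 0)))"

end

theory Submission
  imports Defs
begin

text \<open>
  Write \<open>n\<close> for a unit normal of the abelian ideal \<open>h\<close> and \<open>A = ad n\<close>. If \<open>A\<close> is skew-symmetric, the
  Levi-Civita connection is \<open>D x y = g n x \<cdot> A y\<close>, which is flat.

  For a \<open>Spin(7)\<close> form, \<open>d \<Omega> = 0\<close> says that \<open>A\<close> annihilates \<open>\<Omega>|h\<close>. The triple cross product defined
  by \<open>\<Omega>\<close> is \<open>x (y\<^sup>* z)\<close> in octonions for orthogonal \<open>x, y, z\<close>, so its norm is multiplicative there. By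
  polarization this determines the contractions of \<open>\<Omega>|h\<close> with itself, and contracting \<open>A \<cdot> \<Omega>|h = 0\<close>
  with \<open>\<Omega>|h\<close> gives \<open>g (A x) x = - tr A\<close> for every unit vector \<open>x\<close> of \<open>h\<close>. Taking the trace over the
  seven-dimensional \<open>h\<close> yields \<open>tr A = 0\<close>, so \<open>A\<close> is skew-symmetric.
\<close>

section \<open>Four-fold wedge products, octonions and the triple cross product\<close>

definition minor3 :: "('v \<Rightarrow> real) \<Rightarrow> ('v \<Rightarrow> real) \<Rightarrow> ('v \<Rightarrow> real) \<Rightarrow> 'v \<Rightarrow> 'v \<Rightarrow> 'v \<Rightarrow> real" where
  "minor3 \<alpha> \<beta> \<gamma> x y z =
     \<alpha> x * (\<beta> y * \<gamma> z - \<beta> z * \<gamma> y) - \<alpha> y * (\<beta> x * \<gamma> z - \<beta> z * \<gamma> x) + \<alpha> z * (\<beta> x * \<gamma> y - \<beta> y * \<gamma> x)"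

text \<open>Laplace expansion of a 4 by 4 determinant along \<open>w\<close>, obtained by peeling
  one index at a time off the sum over permutations. It reduces later identities between forms to
  polynomial identities in the values of the covectors.\<close>

lemma wedge4:
  "wedge [\<alpha>, \<beta>, \<gamma>, \<delta>] [x, y, z, w] =
     \<delta> w * minor3 \<alpha> \<beta> \<gamma> x y z - \<gamma> w * minor3 \<alpha> \<beta> \<delta> x y z
     + \<beta> w * minor3 \<alpha> \<gamma> \<delta> x y z - \<alpha> w * minor3 \<beta> \<gamma> \<delta> x y z"
proof -
  have S: "{..<length [\<alpha>, \<beta>, \<gamma>, \<delta>]} = {0, 1, 2, 3::nat}" by auto
  have p: "permutation (Transposition.transpose a b)" for a b :: nat by (rule permutation_swap_id)
  have f: "finite {1, 2, 3::nat}" "0 \<notin> {1, 2, 3::nat}" "finite {2, 3::nat}" "1 \<notin> {2, 3::nat}"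
    "finite {3::nat}" "2 \<notin> {3::nat}" by auto
  show ?thesis
    unfolding wedge_def S
    unfolding sum_over_permutations_insert[OF f(1,2)]
    unfolding sum_over_permutations_insert[OF f(3,4)]
    unfolding sum_over_permutations_insert[OF f(5,6)]
    unfolding permutes_sing
    by (simp add: sign_swap_id p permutation_compose sign_compose Transposition.transpose_def
        numeral_2_eq_2 numeral_3_eq_3 minor3_def) (simp add: algebra_simps)
qed

text \<open>
  The product is read off the \<open>Spin(7)\<close> form: \<open>x z = X(x, e\<^sub>0, z) + (x, e\<^sub>0) z + (e\<^sub>0, z) x - (z, x) e\<^sub>0\<close>
  where \<open>X\<close> is the triple cross product, \<open>(X(x, y, z), w) = \<Omega>(x, y, z, w)\<close>.
\<close>

definition oct :: "(nat \<Rightarrow> real) \<Rightarrow> (nat \<Rightarrow> real) \<Rightarrow> nat \<Rightarrow> real" where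
  "oct x y l = [
     x 0 * y 0 - x 1 * y 1 - x 2 * y 2 - x 3 * y 3 - x 4 * y 4 - x 5 * y 5 - x 6 * y 6 - x 7 * y 7,
     x 0 * y 1 + x 1 * y 0 - x 2 * y 3 + x 3 * y 2 + x 4 * y 5 - x 5 * y 4 + x 6 * y 7 - x 7 * y 6,
     x 0 * y 2 + x 1 * y 3 + x 2 * y 0 - x 3 * y 1 + x 4 * y 6 - x 5 * y 7 - x 6 * y 4 + x 7 * y 5,
     x 0 * y 3 - x 1 * y 2 + x 2 * y 1 + x 3 * y 0 + x 4 * y 7 + x 5 * y 6 - x 6 * y 5 - x 7 * y 4,
     x 0 * y 4 - x 1 * y 5 - x 2 * y 6 - x 3 * y 7 + x 4 * y 0 + x 5 * y 1 + x 6 * y 2 + x 7 * y 3,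
     x 0 * y 5 + x 1 * y 4 + x 2 * y 7 - x 3 * y 6 - x 4 * y 1 + x 5 * y 0 + x 6 * y 3 - x 7 * y 2,
     x 0 * y 6 - x 1 * y 7 + x 2 * y 4 + x 3 * y 5 - x 4 * y 2 - x 5 * y 3 + x 6 * y 0 + x 7 * y 1,
     x 0 * y 7 + x 1 * y 6 - x 2 * y 5 + x 3 * y 4 - x 4 * y 3 + x 5 * y 2 - x 6 * y 1 + x 7 * y 0] ! l"

definition oct_cnj :: "(nat \<Rightarrow> real) \<Rightarrow> nat \<Rightarrow> real" where
  "oct_cnj x l = (if l = 0 then x 0 else - x l)"

definition dot8 :: "(nat \<Rightarrow> real) \<Rightarrow> (nat \<Rightarrow> real) \<Rightarrow> real" where
  "dot8 x y = (\<Sum>i<8. x i * y i)"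

lemma sum8: "(\<Sum>i<8::nat. f i) = f 0 + f 1 + f 2 + f 3 + f 4 + f 5 + f 6 + f (7::nat)"
  for f :: "nat \<Rightarrow> real"
  by (simp add: eval_nat_numeral)

text \<open>Degen's eight-square identity. In coordinates it is a polynomial identity, so no
  alternative-algebra theory is developed.\<close>

lemma oct_norm: "dot8 (oct x y) (oct x y) = dot8 x x * dot8 y y"
  unfolding dot8_def sum8 oct_def
  by simp algebra

lemma oct_cnj_norm: "dot8 (oct_cnj x) (oct_cnj x) = dot8 x x"
  unfolding dot8_def sum8 oct_cnj_def by simp

text \<open>The leading term \<open>x (y\<^sup>* z)\<close> is alternating only up to inner
  products; the correction terms restore this and vanish on mutually orthogonal arguments.\<close>

definition cross8 :: "(nat \<Rightarrow> real) \<Rightarrow> (nat \<Rightarrow> real) \<Rightarrow> (nat \<Rightarrow> real) \<Rightarrow> nat \<Rightarrow> real" where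
  "cross8 x y z l = oct x (oct (oct_cnj y) z) l - dot8 x y * z l - dot8 y z * x l + dot8 z x * y l"

text \<open>Here the fourteen signs of the form meet the octonion multiplication table: once the
  wedges are expanded, both sides are the same polynomial in the coordinates of the four
  vectors.\<close>

lemma spin7_cross8:
  "spin7_form e [x, y, z, w] =
     dot8 (cross8 (\<lambda>i. dual8 e i x) (\<lambda>i. dual8 e i y) (\<lambda>i. dual8 e i z)) (\<lambda>i. dual8 e i w)"
  unfolding dot8_def[of "cross8 _ _ _"] sum8
  unfolding spin7_form_def wedge4 Let_def cross8_def dot8_def sum8 oct_def oct_cnj_def minor3_def
  by simp algebra

section \<open>Orthonormal bases for a variable inner product\<close>

lemma sum_rotate:
  "(\<Sum>k\<in>K. \<Sum>l\<in>L. \<Sum>u\<in>U. f k l u) = (\<Sum>u\<in>U. \<Sum>k\<in>K. \<Sum>l\<in>L. f k l u)"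
proof -
  have "(\<Sum>k\<in>K. \<Sum>l\<in>L. \<Sum>u\<in>U. f k l u) = (\<Sum>k\<in>K. \<Sum>u\<in>U. \<Sum>l\<in>L. f k l u)"
    by (intro sum.cong refl sum.swap)
  also have "\<dots> = (\<Sum>u\<in>U. \<Sum>k\<in>K. \<Sum>l\<in>L. f k l u)"
    by (rule sum.swap)
  finally show ?thesis .
qed

text \<open>The inner product is a variable rather than part of the type, so Gram-Schmidt is carried
  out by hand. The spanning set \<open>T\<close> supplies finite dimension: it bounds the size of
  orthonormal sets and need not be orthonormal itself.\<close>

locale euclidean_form =
  fixes g :: "'v::real_vector \<Rightarrow> 'v \<Rightarrow> real" and T :: "'v set"
  assumes inner: "inner_product g" and finite_T: "finite T" and span_T: "span T = UNIV"
begin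

lemma bilin: "bilinear g" and commute: "g x y = g y x" and pos: "x \<noteq> 0 \<Longrightarrow> g x x > 0"
  using inner by (auto simp: inner_product_def)

lemmas g_simps [simp] = bilinear_ladd[OF bilin] bilinear_radd[OF bilin] bilinear_lsub[OF bilin]
  bilinear_rsub[OF bilin] bilinear_lmul[OF bilin] bilinear_rmul[OF bilin] bilinear_lzero[OF bilin]
  bilinear_rzero[OF bilin] bilinear_lneg[OF bilin] bilinear_rneg[OF bilin]

lemma linear_left: "linear (\<lambda>x. g x y)" and linear_right: "linear (g x)"
  using bilin by (auto simp: bilinear_def)

lemma sum_left: "g (sum f S) y = (\<Sum>s\<in>S. g (f s) y)"
  using linear_sum[OF linear_left] .

definition orthonormal :: "'v set \<Rightarrow> bool" where
  "orthonormal B \<longleftrightarrow> finite B \<and> (\<forall>b\<in>B. \<forall>c\<in>B. g b c = (if b = c then 1 else 0))"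

lemma orthonormalD:
  assumes "orthonormal B"
  shows "finite B" "b \<in> B \<Longrightarrow> c \<in> B \<Longrightarrow> g b c = (if b = c then 1 else 0)"
  using assms by (auto simp: orthonormal_def)

lemma orthonormal_insert:
  assumes "orthonormal B" "g u u = 1" "\<And>b. b \<in> B \<Longrightarrow> g u b = 0"
  shows "orthonormal (insert u B)" "u \<notin> B"
proof -
  have "g b u = 0" if "b \<in> B" for b using assms(3)[OF that] commute[of b u] by simp
  then show "orthonormal (insert u B)" "u \<notin> B" using assms by (auto simp: orthonormal_def)
qed

lemma orthonormal_coeff:
  assumes "orthonormal B" "b \<in> B"
  shows "g (\<Sum>c\<in>B. u c *\<^sub>R c) b = u b"
proof -
  have "g (\<Sum>c\<in>B. u c *\<^sub>R c) b = (\<Sum>c\<in>B. if c = b then u c else 0)"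
    unfolding sum_left by (rule sum.cong) (use assms in \<open>auto simp: orthonormal_def\<close>)
  then show ?thesis using assms by (simp add: orthonormal_def)
qed

lemma orthonormal_expansion:
  assumes "orthonormal B" "x \<in> span B"
  shows "x = (\<Sum>b\<in>B. g x b *\<^sub>R b)"
proof -
  obtain u where u: "x = (\<Sum>b\<in>B. u b *\<^sub>R b)"
    using assms by (auto simp: span_finite orthonormal_def)
  have "g x b = u b" if "b \<in> B" for b
    using orthonormal_coeff[OF assms(1) that] u by simp
  with u show ?thesis by simp
qed

lemma orthonormal_independent:
  assumes "orthonormal B"
  shows "independent B"
proof (rule independent_if_scalars_zero)
  show "finite B" using assms by (simp add: orthonormal_def)
  fix u b assume z: "(\<Sum>c\<in>B. u c *\<^sub>R c) = 0" and b: "b \<in> B"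
  show "u b = 0" using orthonormal_coeff[OF assms b, of u] z by simp
qed

lemma parseval:
  assumes "orthonormal B" "span B = UNIV"
  shows "(\<Sum>b\<in>B. g x b * g y b) = g x y"
proof -
  have "g x y = g (\<Sum>b\<in>B. g x b *\<^sub>R b) y"
    using orthonormal_expansion[OF assms(1)] assms(2) by (metis UNIV_I)
  then show ?thesis by (simp add: sum_left commute[of y])
qed

text \<open>One Gram-Schmidt step: a vector of \<open>W\<close> outside the span loses its
  projection \<open>p\<close> and is then normalized.\<close>

lemma orthonormal_step:
  assumes W: "subspace W" and S: "orthonormal S" "S \<subseteq> W" and ne: "span S \<noteq> W"
  obtains u where "u \<in> W" "u \<notin> S" "orthonormal (insert u S)"
proof -
  have "span S \<subseteq> W" using W S span_minimal by blast
  then obtain v where v: "v \<in> W" "v \<notin> span S" using ne by blast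
  define p where "p = (\<Sum>b\<in>S. g v b *\<^sub>R b)"
  have p: "p \<in> span S" unfolding p_def by (intro span_sum span_scale span_base)
  define w where "w = v - p"
  have w0: "w \<noteq> 0" using v p by (auto simp: w_def)
  have wW: "w \<in> W" unfolding w_def using v p \<open>span S \<subseteq> W\<close> W by (auto intro: subspace_diff)
  have orth: "g w b = 0" if "b \<in> S" for b
    using orthonormal_coeff[OF S(1) that, of "g v"] by (simp add: w_def p_def)
  define u where "u = (1 / sqrt (g w w)) *\<^sub>R w"
  have "g u u = 1" using pos[OF w0] by (simp add: u_def field_simps)
  moreover have "g u b = 0" if "b \<in> S" for b using orth[OF that] by (simp add: u_def)
  moreover have "u \<in> W" unfolding u_def using wW W by (simp add: subspace_scale)
  ultimately show ?thesis using that orthonormal_insert[OF S(1)] by blast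
qed

lemma orthonormal_extend:
  assumes W: "subspace W" and "orthonormal S" "S \<subseteq> W"
  obtains B where "S \<subseteq> B" "B \<subseteq> W" "orthonormal B" "span B = W"
proof -
  have "\<exists>B. S \<subseteq> B \<and> B \<subseteq> W \<and> orthonormal B \<and> span B = W"
    using assms(2,3)
  proof (induction "card T - card S" arbitrary: S rule: less_induct)
    case less
    show ?case
    proof (cases "span S = W")
      case True
      then show ?thesis using less.prems by blast
    next
      case False
      obtain u where u: "u \<in> W" "u \<notin> S" "orthonormal (insert u S)"
        using orthonormal_step[OF W less.prems False] .
      \<comment> \<open>Independence of the enlarged set keeps it within \<open>card T\<close>, so
        the truncated subtraction really decreases.\<close>
      have "card (insert u S) \<le> card T"
        using independent_span_bound[OF finite_T orthonormal_independent[OF u(3)]] span_T by simp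
      then have "card T - card (insert u S) < card T - card S"
        using u less.prems by (simp add: orthonormal_def)
      from less.hyps[OF this u(3)] u less.prems show ?thesis by auto
    qed
  qed
  then show ?thesis using that by blast
qed

end

section \<open>Contractions of a 4-form with multiplicative triple cross product\<close>

text \<open>By Parseval the sum in \<open>cross_norm\<close> is the squared norm of the cross
  product dual to \<Omega>. Stating it for every orthonormal basis \<open>C\<close> avoids the
  vector itself and allows bases adapted to a hyperplane.\<close>

locale cross_form = euclidean_form g T for g :: "'v::real_vector \<Rightarrow> 'v \<Rightarrow> real" and T +
  fixes \<Omega> :: "'v \<Rightarrow> 'v \<Rightarrow> 'v \<Rightarrow> 'v \<Rightarrow> real"
  assumes linear1: "linear (\<lambda>x. \<Omega> x y z w)"
    and swap12: "\<Omega> x y z w = - \<Omega> y x z w"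
    and swap23: "\<Omega> x y z w = - \<Omega> x z y w"
    and swap34: "\<Omega> x y z w = - \<Omega> x y w z"
    and cross_norm: "orthonormal C \<Longrightarrow> span C = UNIV \<Longrightarrow> g x y = 0 \<Longrightarrow> g x z = 0 \<Longrightarrow> g y z = 0 \<Longrightarrow>
      (\<Sum>c\<in>C. (\<Omega> x y z c)\<^sup>2) = g x x * g y y * g z z"
begin

lemma linear2: "linear (\<lambda>y. \<Omega> x y z w)"
proof -
  have "(\<lambda>y. \<Omega> x y z w) = (\<lambda>y. - \<Omega> y x z w)" by (rule ext) (rule swap12)
  then show ?thesis by (simp only:) (rule linear_compose_neg[OF linear1])
qed

lemma linear3: "linear (\<lambda>z. \<Omega> x y z w)"
proof -
  have "(\<lambda>z. \<Omega> x y z w) = (\<lambda>z. - \<Omega> x z y w)" by (rule ext) (rule swap23)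
  then show ?thesis by (simp only:) (rule linear_compose_neg[OF linear2])
qed

lemma alternating: "\<Omega> x x z w = 0" "\<Omega> x y x w = 0" "\<Omega> x y y w = 0" "\<Omega> x y z y = 0"
  using swap12[of x x z w] swap23[of x y y w] swap23[of x y x w] swap12[of x x y w]
    swap34[of x y z y] swap23[of x y y z] by linarith+

text \<open>Polarization of \<open>cross_norm\<close> in the third argument; coincidences with
  \<open>i\<close> or \<open>k\<close> are settled by alternation.\<close>

lemma contraction:
  assumes C: "orthonormal C" "span C = UNIV" and mem: "i \<in> C" "k \<in> C" "j \<in> C" "u \<in> C"
  shows "(\<Sum>c\<in>C. \<Omega> i k j c * \<Omega> i k u c) =
    (if j = u \<and> i \<noteq> k \<and> i \<noteq> j \<and> k \<noteq> j then 1 else 0)"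
proof (cases "i = k \<or> j \<in> {i, k} \<or> u \<in> {i, k}")
  case True
  then show ?thesis by (auto simp: alternating)
next
  case False
  then have ne: "i \<noteq> k" "k \<noteq> i" "i \<noteq> j" "k \<noteq> j" "i \<noteq> u" "k \<noteq> u" by auto
  note ip = orthonormalD(2)[OF C(1)]
  have one: "(\<Sum>c\<in>C. (\<Omega> i k v c)\<^sup>2) = g v v" if "g i v = 0" "g k v = 0" for v
    using cross_norm[OF C, of i k v] that mem ne ip by simp
  show ?thesis
  proof (cases "j = u")
    case True
    then show ?thesis using one[of j] mem ne ip by (simp add: power2_eq_square)
  next
    case ju: False
    \<comment> \<open>As \<open>j + u\<close> has squared norm 2 and the two pure terms are 1 each,
      the mixed term vanishes.\<close>
    have "(\<Sum>c\<in>C. (\<Omega> i k (j + u) c)\<^sup>2) = (\<Sum>c\<in>C. (\<Omega> i k j c)\<^sup>2) +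
        (\<Sum>c\<in>C. (\<Omega> i k u c)\<^sup>2) + 2 * (\<Sum>c\<in>C. \<Omega> i k j c * \<Omega> i k u c)"
      by (simp add: linear_add[OF linear3] power2_sum sum.distrib sum_distrib_left mult.assoc)
    then show ?thesis using one[of j] one[of u] one[of "j + u"] mem ne ju ip by simp
  qed
qed

end

section \<open>The trace identity on a hyperplane\<close>

locale adapted_frame = cross_form g T \<Omega> for g :: "'v::real_vector \<Rightarrow> 'v \<Rightarrow> real" and T and \<Omega> +
  fixes n :: 'v and B :: "'v set"
  assumes onb: "orthonormal (insert n B)" "span (insert n B) = UNIV" and n: "n \<notin> B"
    and card_B: "card B = 7"
begin

lemma finite_B: "finite B" using card_B by (simp add: card_ge_0_finite)

lemma onb_B: "orthonormal B" using onb finite_B by (auto simp: orthonormal_def)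

text \<open>For \<open>j = u\<close> distinct from \<open>i\<close>, the contraction over the full
  basis is 1 for each of the five \<open>k\<close> outside \<open>i, j\<close>. Dropping the terms
  with \<open>l = n\<close> removes another full contraction, with \<open>i\<close> and
  \<open>n\<close> fixed, of value 1. This leaves 5 - 1 = 4.\<close>

lemma hyperplane_contraction:
  assumes "i \<in> B" "j \<in> B" "u \<in> B"
  shows "(\<Sum>k\<in>B. \<Sum>l\<in>B. \<Omega> i j k l * \<Omega> i u k l) = (if j = u \<and> i \<noteq> j then 4 else 0)"
proof -
  have 1: "(\<Sum>l\<in>B. \<Omega> i j k l * \<Omega> i u k l) =
      (if j = u \<and> i \<noteq> j then if k \<in> {i, j} then 0 else 1 else 0) - \<Omega> i n j k * \<Omega> i n u k"
    if "k \<in> B" for k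
  proof -
    \<comment> \<open>Exchanging the second and fourth slots gives the dropped term the shape of a
      contraction with \<open>i, n\<close> fixed.\<close>
    have "\<Omega> i k v n = - \<Omega> i n v k" for v
      using swap34[of i k v n] swap23[of i k n v] swap34[of i n k v] by linarith
    moreover have "(\<Sum>l\<in>B. \<Omega> i j k l * \<Omega> i u k l) = (\<Sum>l\<in>B. \<Omega> i k j l * \<Omega> i k u l)"
      using swap23[of i j k] swap23[of i u k] by simp
    moreover have "(\<Sum>l\<in>insert n B. \<Omega> i k j l * \<Omega> i k u l) =
        \<Omega> i k j n * \<Omega> i k u n + (\<Sum>l\<in>B. \<Omega> i k j l * \<Omega> i k u l)"
      using finite_B n by simp
    ultimately have "(\<Sum>l\<in>B. \<Omega> i j k l * \<Omega> i u k l) =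
        (if j = u \<and> i \<noteq> k \<and> i \<noteq> j \<and> k \<noteq> j then 1 else 0) - \<Omega> i n j k * \<Omega> i n u k"
      using contraction[OF onb, of i k j u] that assms by simp
    also have "(if j = u \<and> i \<noteq> k \<and> i \<noteq> j \<and> k \<noteq> j then 1 else 0::real) =
        (if j = u \<and> i \<noteq> j then if k \<in> {i, j} then 0 else 1 else 0)" by auto
    finally show ?thesis .
  qed
  have 2: "(\<Sum>k\<in>B. \<Omega> i n j k * \<Omega> i n u k) = (if j = u \<and> i \<noteq> j then 1 else 0)"
  proof -
    \<comment> \<open>The term \<open>l = n\<close> is zero by alternation, so summing over
      \<open>B\<close> is already a full contraction.\<close>
    have "(\<Sum>l\<in>insert n B. \<Omega> i n j l * \<Omega> i n u l) = (\<Sum>l\<in>B. \<Omega> i n j l * \<Omega> i n u l)"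
      using finite_B n by (simp add: alternating)
    moreover have "i \<noteq> n" "n \<noteq> j" using assms n by auto
    ultimately show ?thesis using contraction[OF onb, of i n j u] assms by simp
  qed
  have 3: "(\<Sum>k\<in>B. if k \<in> {i, j} then 0 else 1::real) = 5" if "i \<noteq> j"
  proof -
    have "(\<Sum>k\<in>B. if k \<in> {i, j} then 0 else 1::real) = (\<Sum>k\<in>B - {i, j}. 1)"
      by (rule sum.mono_neutral_cong_right) (use finite_B in auto)
    also have "\<dots> = 5" using card_Diff_subset[of "{i, j}" B] that assms card_B by simp
    finally show ?thesis .
  qed
  define P where "P \<longleftrightarrow> j = u \<and> i \<noteq> j"
  have five: "(\<Sum>k\<in>B. if k \<in> {i, j} then 0 else 1::real) = 5" if P
    using 3 that unfolding P_def by blast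
  show ?thesis
    unfolding P_def[symmetric] using five
    by (cases P) (simp_all add: 1[folded P_def] 2[folded P_def] sum_subtractf sum_negf del: insert_iff)
qed

text \<open>
  The sum over \<open>j, k, l\<close> of the invariance equation times \<open>\<Omega> i j k l\<close> reads
  \<open>24 g (A i) i + 3 \<cdot> 4 (tr A - g (A i) i) = 0\<close>.
\<close>

lemma trace_identity:
  assumes A: "\<And>b. b \<in> B \<Longrightarrow> A b \<in> span B" and i: "i \<in> B"
    and inv: "\<And>j k l. j \<in> B \<Longrightarrow> k \<in> B \<Longrightarrow> l \<in> B \<Longrightarrow>
      \<Omega> (A i) j k l + \<Omega> i (A j) k l + \<Omega> i j (A k) l + \<Omega> i j k (A l) = 0"
  shows "g (A i) i = - (\<Sum>j\<in>B. g (A j) j)"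
proof -
  have A_exp: "A b = (\<Sum>u\<in>B. g (A b) u *\<^sub>R u)" if "b \<in> B" for b
    using orthonormal_expansion[OF onb_B A[OF that]] .
  have "(\<Sum>j\<in>B. \<Sum>k\<in>B. \<Sum>l\<in>B. \<Omega> (A i) j k l * \<Omega> i j k l) =
      (\<Sum>j\<in>B. \<Sum>k\<in>B. \<Sum>l\<in>B. \<Sum>u\<in>B. g (A i) u * (\<Omega> j u k l * \<Omega> j i k l))"
    (is "?S1 = _")
  proof (intro sum.cong refl)
    fix j k l
    have "\<Omega> (A i) j k l = (\<Sum>u\<in>B. g (A i) u * \<Omega> u j k l)"
      by (subst A_exp[OF i]) (simp add: linear_sum[OF linear1] linear_cmul[OF linear1])
    then have "\<Omega> (A i) j k l * \<Omega> i j k l = (\<Sum>u\<in>B. g (A i) u * (\<Omega> u j k l * \<Omega> i j k l))"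
      by (simp add: sum_distrib_right mult.assoc)
    \<comment> \<open>Both factors change sign, and \<open>j\<close> moves to the first slot, where
      \<open>hyperplane_contraction\<close> expects the common index.\<close>
    moreover have "\<Omega> u j k l * \<Omega> i j k l = \<Omega> j u k l * \<Omega> j i k l" for u
      by (metis swap12 minus_mult_minus)
    ultimately show "\<Omega> (A i) j k l * \<Omega> i j k l =
        (\<Sum>u\<in>B. g (A i) u * (\<Omega> j u k l * \<Omega> j i k l))" by simp
  qed
  also have "\<dots> = (\<Sum>j\<in>B. \<Sum>u\<in>B. g (A i) u * (\<Sum>k\<in>B. \<Sum>l\<in>B. \<Omega> j u k l * \<Omega> j i k l))"
    unfolding sum_distrib_left by (intro sum.cong refl sum_rotate)
  also have "\<dots> = (\<Sum>j\<in>B. \<Sum>u\<in>B. g (A i) u * (if u = i \<and> j \<noteq> u then 4 else 0))"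
    by (intro sum.cong refl) (simp add: hyperplane_contraction i)
  also have "\<dots> = (\<Sum>j\<in>B. 4 * g (A i) i - (if j = i then 4 * g (A i) i else 0))"
  proof (rule sum.cong[OF refl])
    fix j
    have "(\<Sum>u\<in>B. g (A i) u * (if u = i \<and> j \<noteq> u then 4 else 0)) =
        (\<Sum>u\<in>B. if u = i then 4 * g (A i) i - (if j = i then 4 * g (A i) i else 0) else 0)"
      by (rule sum.cong) auto
    then show "(\<Sum>u\<in>B. g (A i) u * (if u = i \<and> j \<noteq> u then 4 else 0)) =
        4 * g (A i) i - (if j = i then 4 * g (A i) i else 0)"
      using finite_B i by simp
  qed
  \<comment> \<open>Six of the seven \<open>j\<close> differ from \<open>i\<close>, each
    contributing 4.\<close>
  also have "\<dots> = 24 * g (A i) i"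
    using finite_B i card_B by (simp add: sum_subtractf)
  finally have S1: "?S1 = 24 * g (A i) i" .
  have "(\<Sum>j\<in>B. \<Sum>k\<in>B. \<Sum>l\<in>B. \<Omega> i (A j) k l * \<Omega> i j k l) =
      (\<Sum>j\<in>B. \<Sum>k\<in>B. \<Sum>l\<in>B. \<Sum>u\<in>B. g (A j) u * (\<Omega> i u k l * \<Omega> i j k l))"
    (is "?S2 = _")
  proof (intro sum.cong refl)
    fix j k l assume "j \<in> B"
    have "\<Omega> i (A j) k l = (\<Sum>u\<in>B. g (A j) u * \<Omega> i u k l)"
      by (subst A_exp[OF \<open>j \<in> B\<close>]) (simp add: linear_sum[OF linear2] linear_cmul[OF linear2])
    then show "\<Omega> i (A j) k l * \<Omega> i j k l = (\<Sum>u\<in>B. g (A j) u * (\<Omega> i u k l * \<Omega> i j k l))"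
      by (simp add: sum_distrib_right mult.assoc)
  qed
  also have "\<dots> = (\<Sum>j\<in>B. \<Sum>u\<in>B. g (A j) u * (\<Sum>k\<in>B. \<Sum>l\<in>B. \<Omega> i u k l * \<Omega> i j k l))"
    unfolding sum_distrib_left by (intro sum.cong refl sum_rotate)
  also have "\<dots> = (\<Sum>j\<in>B. \<Sum>u\<in>B. g (A j) u * (if u = j \<and> i \<noteq> u then 4 else 0))"
    by (intro sum.cong refl) (simp add: hyperplane_contraction i)
  also have "\<dots> = (\<Sum>j\<in>B. 4 * g (A j) j - (if j = i then 4 * g (A j) j else 0))"
  proof (rule sum.cong[OF refl])
    fix j assume "j \<in> B"
    have "(\<Sum>u\<in>B. g (A j) u * (if u = j \<and> i \<noteq> u then 4 else 0)) =
        (\<Sum>u\<in>B. if u = j then 4 * g (A j) j - (if j = i then 4 * g (A j) j else 0) else 0)"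
      by (rule sum.cong) auto
    then show "(\<Sum>u\<in>B. g (A j) u * (if u = j \<and> i \<noteq> u then 4 else 0)) =
        4 * g (A j) j - (if j = i then 4 * g (A j) j else 0)"
      using finite_B \<open>j \<in> B\<close> by simp
  qed
  also have "\<dots> = 4 * ((\<Sum>j\<in>B. g (A j) j) - g (A i) i)"
    using finite_B i by (simp add: sum_subtractf sum_distrib_left[symmetric])
  finally have S2: "?S2 = 4 * ((\<Sum>j\<in>B. g (A j) j) - g (A i) i)" .
  \<comment> \<open>By alternation the last three sums agree after renaming summation indices:
    \<open>j\<close> with \<open>k\<close> here, \<open>k\<close> with \<open>l\<close> in the next
    one.\<close>
  have S3: "(\<Sum>j\<in>B. \<Sum>k\<in>B. \<Sum>l\<in>B. \<Omega> i j (A k) l * \<Omega> i j k l) = ?S2" (is "?S3 = _")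
  proof -
    have "?S3 = (\<Sum>k\<in>B. \<Sum>j\<in>B. \<Sum>l\<in>B. \<Omega> i j (A k) l * \<Omega> i j k l)" by (rule sum.swap)
    also have "\<dots> = ?S2" by (intro sum.cong refl) (metis swap23 minus_mult_minus)
    finally show ?thesis .
  qed
  have S4: "(\<Sum>j\<in>B. \<Sum>k\<in>B. \<Sum>l\<in>B. \<Omega> i j k (A l) * \<Omega> i j k l) = ?S3" (is "?S4 = _")
  proof (rule sum.cong[OF refl])
    fix j
    have "(\<Sum>k\<in>B. \<Sum>l\<in>B. \<Omega> i j k (A l) * \<Omega> i j k l) = (\<Sum>l\<in>B. \<Sum>k\<in>B. \<Omega> i j k (A l) * \<Omega> i j k l)"
      by (rule sum.swap)
    also have "\<dots> = (\<Sum>k\<in>B. \<Sum>l\<in>B. \<Omega> i j (A k) l * \<Omega> i j k l)"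
      by (intro sum.cong refl) (metis swap34 minus_mult_minus)
    finally show "(\<Sum>k\<in>B. \<Sum>l\<in>B. \<Omega> i j k (A l) * \<Omega> i j k l) = \<dots>" .
  qed
  have "?S1 + ?S2 + ?S3 + ?S4 = (\<Sum>j\<in>B. \<Sum>k\<in>B. \<Sum>l\<in>B.
      (\<Omega> (A i) j k l + \<Omega> i (A j) k l + \<Omega> i j (A k) l + \<Omega> i j k (A l)) * \<Omega> i j k l)"
    by (simp add: sum.distrib distrib_right)
  also have "\<dots> = 0" by (intro sum.neutral ballI) (simp add: inv)
  finally show ?thesis using S1 S2 S3 S4 by simp
qed

lemma diagonal_zero:
  assumes A: "\<And>b. b \<in> B \<Longrightarrow> A b \<in> span B" and i: "i \<in> B"
    and inv: "\<And>i j k l. i \<in> B \<Longrightarrow> j \<in> B \<Longrightarrow> k \<in> B \<Longrightarrow> l \<in> B \<Longrightarrow>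
      \<Omega> (A i) j k l + \<Omega> i (A j) k l + \<Omega> i j (A k) l + \<Omega> i j k (A l) = 0"
  shows "g (A i) i = 0"
proof -
  let ?t = "\<Sum>j\<in>B. g (A j) j"
  have eq: "g (A b) b = - ?t" if "b \<in> B" for b
    using trace_identity[OF A that inv] that by blast
  \<comment> \<open>With seven basis vectors this says \<open>t = -7 t\<close>.\<close>
  have "?t = (\<Sum>b\<in>B. - ?t)" by (rule sum.cong[OF refl eq])
  then show ?thesis using eq[OF i] card_B by simp
qed

end

section \<open>Flatness from skew-symmetry\<close>

text \<open>All operators \<open>D x\<close> are multiples of \<open>A\<close>, so they commute;
  brackets lie in the range of \<open>A\<close>, which is orthogonal to \<open>n\<close>, so
  \<open>D (br x y)\<close> vanishes. Skewness of \<open>A\<close> is metric compatibility.\<close>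

lemma flat_skew:
  assumes g: "inner_product g" and A: "linear A"
    and skew: "\<And>x y. g (A x) y + g x (A y) = 0"
    and br: "\<And>x y. br x y = g n x *\<^sub>R A y - g n y *\<^sub>R A x"
    and nA: "\<And>x. g n (A x) = 0"
  shows "flat br g"
proof -
  define D where "D x y = g n x *\<^sub>R A y" for x y
  have bil: "bilinear g" using g by (simp add: inner_product_def)
  note s = bilinear_ladd[OF bil] bilinear_radd[OF bil] bilinear_rsub[OF bil] bilinear_lmul[OF bil]
    bilinear_rmul[OF bil] linear_add[OF A] linear_cmul[OF A]
  have "bilinear D"
    unfolding bilinear_def by (auto intro!: linearI simp: D_def s algebra_simps)
  moreover have "g (D x y) z + g y (D x z) = 0" for x y z
    using skew[of y z] by (simp add: D_def s distrib_left[symmetric])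
  ultimately have "levi_civita br g D"
    by (simp add: levi_civita_def D_def br)
  moreover have "curvature br D x y z = 0" for x y z
    by (simp add: curvature_def D_def br s nA)
  ultimately show ?thesis unfolding flat_def by blast
qed

lemma inner_product_inner: "inner_product ((\<bullet>) :: 'a::real_inner \<Rightarrow> 'a \<Rightarrow> real)"
  unfolding inner_product_def bilinear_def
  by (auto intro!: linearI simp: inner_simps inner_commute)

lemma flat_ext_bracket:
  assumes E: "linear E" and skew: "\<And>x y. E x \<bullet> y = - (x \<bullet> E y)"
  shows "flat (ext_bracket E) (\<bullet>)"
\<comment> \<open>The unit normal is \<open>e\<^sub>0\<close>, and \<open>A\<close> is its adjoint
  action, hence zero on \<open>e\<^sub>0\<close>.\<close>
proof (rule flat_skew[where n = "(1, 0)" and A = "\<lambda>v. (0, E (snd v))"])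
  show "linear (\<lambda>v. (0, E (snd v)))"
    by (rule linearI) (simp_all add: linear_add[OF E] linear_cmul[OF E])
qed (auto simp: inner_product_inner skew ext_bracket_def)

section \<open>Spin(7) forms have a multiplicative cross product\<close>

lemma wedge4_swaps:
  "wedge [\<alpha>, \<beta>, \<gamma>, \<delta>] [y, x, z, w] = - wedge [\<alpha>, \<beta>, \<gamma>, \<delta>] [x, y, z, w]"
  "wedge [\<alpha>, \<beta>, \<gamma>, \<delta>] [x, z, y, w] = - wedge [\<alpha>, \<beta>, \<gamma>, \<delta>] [x, y, z, w]"
  "wedge [\<alpha>, \<beta>, \<gamma>, \<delta>] [x, y, w, z] = - wedge [\<alpha>, \<beta>, \<gamma>, \<delta>] [x, y, z, w]"
  by (simp_all add: wedge4 minor3_def algebra_simps)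

lemma spin7_form_swaps:
  "spin7_form e [y, x, z, w] = - spin7_form e [x, y, z, w]"
  "spin7_form e [x, z, y, w] = - spin7_form e [x, y, z, w]"
  "spin7_form e [x, y, w, z] = - spin7_form e [x, y, z, w]"
  unfolding spin7_form_def Let_def
  \<comment> \<open>Fixing the vectors orients each swap; left general, the equations would rewrite
    back and forth.\<close>
  by (simp_all only: wedge4_swaps(1)[of _ _ _ _ y x] wedge4_swaps(2)[of _ _ _ _ x z y]
      wedge4_swaps(3)[of _ _ _ _ x y w z])

lemma linear_wedge4:
  assumes "linear \<alpha>" "linear \<beta>" "linear \<gamma>" "linear \<delta>"
  shows "linear (\<lambda>x. wedge [\<alpha>, \<beta>, \<gamma>, \<delta>] [x, y, z, w])"
  by (rule linearI) (simp_all add: wedge4 minor3_def assms[THEN linear_add] assms[THEN linear_cmul]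
      algebra_simps)

lemma linear_dual8:
  assumes "basis8 e"
  shows "linear (dual8 e i)"
  using assms by (intro linearI)
    (simp_all add: basis8_def dual8_def real_vector.representation_add real_vector.representation_scale)

lemma linear_spin7_form:
  assumes "basis8 e"
  shows "linear (\<lambda>x. spin7_form e [x, y, z, w])"
  unfolding spin7_form_def Let_def
  by (intro linear_compose_add linear_compose_sub linear_wedge4 linear_dual8 assms)

text \<open>Orthogonality removes the correction terms, and the eight-square identity applies
  twice.\<close>

lemma cross8_norm:
  assumes "dot8 x y = 0" "dot8 x z = 0" "dot8 y z = 0"
  shows "dot8 (cross8 x y z) (cross8 x y z) = dot8 x x * dot8 y y * dot8 z z"
proof -
  have "dot8 z x = 0" using assms(2) by (simp add: dot8_def mult.commute)
  then have "cross8 x y z = oct x (oct (oct_cnj y) z)" using assms by (simp add: cross8_def fun_eq_iff)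
  then show ?thesis by (simp add: oct_norm oct_cnj_norm)
qed

lemma cross_form_spin7:
  fixes e :: "nat \<Rightarrow> 'v::real_vector"
  assumes e: "basis8 e" and g: "inner_product g"
    and on: "\<And>i j. i < 8 \<Longrightarrow> j < 8 \<Longrightarrow> g (e i) (e j) = (if i = j then 1 else 0)"
  shows "cross_form g (e ` {..<8}) (\<lambda>x y z w. spin7_form e [x, y, z, w])"
proof -
  interpret euclidean_form g "e ` {..<8}"
    by standard (use e g in \<open>auto simp: basis8_def\<close>)
  have inj: "inj_on e {..<8}" using e by (simp add: basis8_def)
  have on_e: "orthonormal (e ` {..<8})"
    using on inj by (auto simp: orthonormal_def inj_on_eq_iff)
  have dual: "dual8 e i v = g v (e i)" if i: "i < 8" for i v
  proof (rule linear_eq_on_span[OF linear_dual8[OF e] linear_left])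
    show "v \<in> span (e ` {..<8})" by (simp add: span_T)
    fix b assume "b \<in> e ` {..<8}"
    then obtain j where j: "j < 8" "b = e j" by auto
    have "e i = e j \<longleftrightarrow> i = j" using inj i j by (auto simp: inj_on_eq_iff)
    then show "dual8 e i b = g b (e i)"
      using e i j on by (simp add: dual8_def basis8_def real_vector.representation_basis)
  qed
  have dot: "dot8 (\<lambda>i. dual8 e i v) (\<lambda>i. dual8 e i w) = g v w" for v w
  proof -
    have "dot8 (\<lambda>i. dual8 e i v) (\<lambda>i. dual8 e i w) = (\<Sum>i<8. g v (e i) * g w (e i))"
      by (simp add: dot8_def dual)
    also have "\<dots> = (\<Sum>b\<in>e ` {..<8}. g v b * g w b)" by (simp add: sum.reindex[OF inj])
    also have "\<dots> = g v w" using parseval[OF on_e span_T] .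
    finally show ?thesis .
  qed
  show ?thesis
  proof (intro cross_form.intro cross_form_axioms.intro euclidean_form_axioms)
    fix x y z w :: 'v
    show "linear (\<lambda>x. spin7_form e [x, y, z, w])" using linear_spin7_form[OF e] .
    show "spin7_form e [x, y, z, w] = - spin7_form e [y, x, z, w]"
      "spin7_form e [x, y, z, w] = - spin7_form e [x, z, y, w]"
      "spin7_form e [x, y, z, w] = - spin7_form e [x, y, w, z]"
      by (rule spin7_form_swaps)+
  next
    fix C and x y z :: 'v
    assume C: "orthonormal C" "span C = UNIV" and orth: "g x y = 0" "g x z = 0" "g y z = 0"
    let ?c = "cross8 (\<lambda>i. dual8 e i x) (\<lambda>i. dual8 e i y) (\<lambda>i. dual8 e i z)"
    \<comment> \<open>The cross product as a vector: by \<open>spin7_cross8\<close>, the form on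
      \<open>x, y, z, w\<close> is \<open>g X w\<close>, so Parseval applies in any orthonormal
      basis \<open>C\<close>.\<close>
    define X where "X = (\<Sum>i<8. ?c i *\<^sub>R e i)"
    have X: "dual8 e i X = ?c i" if "i < 8" for i
    proof -
      have "dual8 e i X = (\<Sum>j<8. if j = i then ?c j else 0)"
        unfolding dual[OF that] X_def sum_left by (rule sum.cong) (use on that in auto)
      then show ?thesis using that by simp
    qed
    then have X_dot: "dot8 ?c f = dot8 (\<lambda>i. dual8 e i X) f" for f by (simp add: dot8_def)
    have "(\<Sum>c\<in>C. (spin7_form e [x, y, z, c])\<^sup>2) = (\<Sum>c\<in>C. g X c * g X c)"
      unfolding spin7_cross8 X_dot dot power2_eq_square ..
    also have "\<dots> = g X X" by (rule parseval[OF C])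
    also have "\<dots> = dot8 ?c ?c" unfolding dot[symmetric] using X by (simp add: dot8_def)
    also have "\<dots> = g x x * g y y * g z z"
      by (subst cross8_norm) (simp_all add: dot orth)
    finally show "(\<Sum>c\<in>C. (spin7_form e [x, y, z, c])\<^sup>2) = g x x * g y y * g z z" .
  qed
qed

section \<open>Closed Spin(7) forms on quasi abelian Lie algebras\<close>

lemma ext_deriv_4:
  "ext_deriv br \<omega> [a, b, c, d, f] =
     - \<omega> [br a b, c, d, f] + \<omega> [br a c, b, d, f] - \<omega> [br a d, b, c, f] + \<omega> [br a f, b, c, d]
     - \<omega> [br b c, a, d, f] + \<omega> [br b d, a, c, f] - \<omega> [br b f, a, c, d]
     - \<omega> [br c d, a, b, f] + \<omega> [br c f, a, b, d] - \<omega> [br d f, a, b, c]"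
proof -
  have I: "{..<length [a, b, c, d, f]} = {0, 1, 2, 3, 4}" "{0<..<length [a, b, c, d, f]} = {1, 2, 3, 4}"
    "{1<..<length [a, b, c, d, f]} = {2, 3, 4}" "{2<..<length [a, b, c, d, f]} = {3, 4}"
    "{3<..<length [a, b, c, d, f]} = {4}" "{4<..<length [a, b, c, d, f]} = {}"
    by auto
  show ?thesis
    unfolding ext_deriv_def I(1)
    by (simp add: I[simplified] nths_Cons)
qed

context cross_form
begin

text \<open>\<open>diagonal_zero\<close> speaks of basis vectors only. Each unit vector
  \<open>u\<close> of \<open>h\<close> is therefore completed to its own orthonormal basis of
  \<open>h\<close>; scaling and polarization then give skewness.\<close>

lemma invariant_imp_skew:
  assumes h: "subspace h" and orth: "\<And>x. x \<in> h \<Longrightarrow> g n x = 0" and n: "g n n = 1"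
    and B: "orthonormal B" "span B = h" "card B = 7"
    and full: "span (insert n B) = UNIV"
    and A: "linear A" "\<And>x. x \<in> h \<Longrightarrow> A x \<in> h"
    and inv: "\<And>x y z w. x \<in> h \<Longrightarrow> y \<in> h \<Longrightarrow> z \<in> h \<Longrightarrow> w \<in> h \<Longrightarrow>
      \<Omega> (A x) y z w + \<Omega> x (A y) z w + \<Omega> x y (A z) w + \<Omega> x y z (A w) = 0"
    and x: "x \<in> h" and y: "y \<in> h"
  shows "g (A x) y + g x (A y) = 0"
proof -
  have unit: "g (A u) u = 0" if u: "u \<in> h" "g u u = 1" for u
  proof -
    have "orthonormal {u}" using u by (simp add: orthonormal_def)
    then obtain B' where B': "{u} \<subseteq> B'" "B' \<subseteq> h" "orthonormal B'" "span B' = h"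
      using orthonormal_extend[OF h] u by blast
    have "card B' = 7"
      using dim_eq_card[OF _ orthonormal_independent] B B' by metis
    moreover have "orthonormal (insert n B')" "n \<notin> B'"
      using orthonormal_insert[OF B'(3) n] B'(2) orth by auto
    moreover have "span (insert n B') = UNIV"
      using full B'(4) B(2) by (simp only: span_insert)
    ultimately interpret adapted_frame g T \<Omega> n B'
      by (intro adapted_frame.intro adapted_frame_axioms.intro cross_form_axioms)
    show ?thesis
    proof (rule diagonal_zero)
      show "A b \<in> span B'" if "b \<in> B'" for b using A(2) B' that by blast
      show "u \<in> B'" using B' by simp
      show "\<Omega> (A i) j k l + \<Omega> i (A j) k l + \<Omega> i j (A k) l + \<Omega> i j k (A l) = 0"
        if "i \<in> B'" "j \<in> B'" "k \<in> B'" "l \<in> B'" for i j k l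
        using that B'(2) by (intro inv) auto
    qed
  qed
  have diag: "g (A u) u = 0" if u: "u \<in> h" for u
  proof (cases "u = 0")
    case True
    then show ?thesis by simp
  next
    case False
    define v where "v = (1 / sqrt (g u u)) *\<^sub>R u"
    have "g v v = 1" using pos[OF False] by (simp add: v_def field_simps)
    moreover have "v \<in> h" unfolding v_def using u h by (simp add: subspace_scale)
    ultimately have "g (A v) v = 0" using unit by blast
    then show ?thesis using pos[OF False] by (simp add: v_def linear_cmul[OF A(1)])
  qed
  have "g (A (x + y)) (x + y) = 0" using diag[OF subspace_add[OF h x y]] .
  then show ?thesis
    using diag[OF x] diag[OF y] commute[of "A y" x] by (simp add: linear_add[OF A(1)])
qed

end

lemma flat_spin7:
  fixes br :: "'v::real_vector \<Rightarrow> 'v \<Rightarrow> 'v"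
  assumes qa: "quasi_abelian br" and spin: "spin7_structure \<Omega> g" and closed: "closed_form br 4 \<Omega>"
  shows "flat br g"
proof -
  obtain e where e: "basis8 e" and \<Omega>: "\<And>vs. length vs = 4 \<Longrightarrow> \<Omega> vs = spin7_form e vs"
    and g: "inner_product g"
    and on: "\<And>i j. i < 8 \<Longrightarrow> j < 8 \<Longrightarrow> g (e i) (e j) = (if i = j then 1 else 0)"
    using spin by (auto simp: spin7_structure_def)
  interpret cross_form g "e ` {..<8}" "\<lambda>x y z w. spin7_form e [x, y, z, w]"
    by (rule cross_form_spin7[OF e g on])
  obtain h where br: "lie_algebra br" and h: "abelian_ideal br h"
    and dim_h: "dim h + 1 = dim (UNIV :: 'v set)"
    using qa by (auto simp: quasi_abelian_def)
  have h_sub: "subspace h" and ideal: "\<And>x y. y \<in> h \<Longrightarrow> br x y \<in> h"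
    and abel: "\<And>x y. x \<in> h \<Longrightarrow> y \<in> h \<Longrightarrow> br x y = 0"
    using h by (auto simp: abelian_ideal_def)
  have br_bil: "bilinear br" and br_alt: "br x x = 0" for x
    using br by (auto simp: lie_algebra_def)
  have dim8: "dim (UNIV :: 'v set) = 8"
    using e dim_eq_card[of "e ` {..<8}" "UNIV :: 'v set"] by (simp add: basis8_def card_image)
  obtain B where B: "B \<subseteq> h" "orthonormal B" "span B = h"
    using orthonormal_extend[OF h_sub, of "{}"] by (auto simp: orthonormal_def)
  have card_B: "card B = 7"
    using dim_eq_card[of B h] B orthonormal_independent h_sub dim_h dim8
    by (simp add: span_eq_iff[THEN iffD2])
  obtain C where C: "B \<subseteq> C" "orthonormal C" "span C = UNIV"
    using orthonormal_extend[OF subspace_UNIV B(2)] by auto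
  have "card C = 8"
    using dim_eq_card[of C UNIV] C orthonormal_independent dim8 by simp
  \<comment> \<open>Extending an orthonormal basis of the ideal to the whole space adds exactly one
    vector, the unit normal.\<close>
  then have "card (C - B) = 1"
    using C(1) card_B orthonormalD(1)[OF B(2)] by (simp add: card_Diff_subset)
  then obtain n where "C - B = {n}" by (rule card_1_singletonE)
  then have C_eq: "C = insert n B" and n: "n \<in> C" "n \<notin> B" using C(1) by auto
  have n_unit: "g n n = 1" using orthonormalD(2)[OF C(2) n(1) n(1)] by simp
  have n_orth: "g n x = 0" if "x \<in> h" for x
  proof (rule linear_eq_on_span[OF linear_right linear_zero, where B = B])
    show "x \<in> span B" using that B by simp
    show "g n b = 0" if "b \<in> B" for b
      using orthonormalD(2)[OF C(2) n(1), of b] that n C by auto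
  qed
  have linear_A: "linear (br n)" using br_bil by (simp add: bilinear_def)
  have split: "x - g n x *\<^sub>R n \<in> h" for x
  proof -
    have "x = (\<Sum>b\<in>C. g x b *\<^sub>R b)" using orthonormal_expansion[OF C(2)] C(3) by blast
    also have "\<dots> = g x n *\<^sub>R n + (\<Sum>b\<in>B. g x b *\<^sub>R b)"
      using n orthonormalD(1)[OF B(2)] by (simp add: C_eq)
    finally have "x - g n x *\<^sub>R n = (\<Sum>b\<in>B. g x b *\<^sub>R b)"
      by (simp add: commute[of n] algebra_simps)
    then show ?thesis using B(1) h_sub by (auto intro!: subspace_sum subspace_scale)
  qed
  have A_split: "br n x = br n (x - g n x *\<^sub>R n)" for x
    by (simp add: linear_diff[OF linear_A] linear_cmul[OF linear_A] br_alt)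
  have A_h: "br n x \<in> h" for x
    using ideal[OF split] A_split by metis
  \<comment> \<open>In d\<Omega> evaluated on \<open>n, x, y, z, w\<close>, brackets within
    \<open>h\<close> vanish. Moving each remaining bracket to its own slot leaves minus the sum
    below.\<close>
  have inv: "spin7_form e [br n x, y, z, w] + spin7_form e [x, br n y, z, w]
      + spin7_form e [x, y, br n z, w] + spin7_form e [x, y, z, br n w] = 0"
    if "x \<in> h" "y \<in> h" "z \<in> h" "w \<in> h" for x y z w
  proof -
    have "ext_deriv br \<Omega> [n, x, y, z, w] = 0" using closed by (simp add: closed_form_def)
    moreover have "spin7_form e [0, a, b, c] = 0" for a b c
      using linear_0[OF linear1] .
    moreover have "spin7_form e [br n y, x, z, w] = - spin7_form e [x, br n y, z, w]"
      "spin7_form e [br n z, x, y, w] = spin7_form e [x, y, br n z, w]"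
      "spin7_form e [br n w, x, y, z] = - spin7_form e [x, y, z, br n w]"
      by (metis spin7_form_swaps minus_minus)+
    ultimately show ?thesis using that by (simp add: ext_deriv_4 \<Omega> abel)
  qed
  have skew_h: "g (br n x) y + g x (br n y) = 0" if "x \<in> h" "y \<in> h" for x y
    using invariant_imp_skew[OF h_sub n_orth n_unit B(2,3) card_B _ linear_A A_h inv that] C C_eq
    by simp
  \<comment> \<open>Skewness passes from \<open>h\<close> to the whole space because
    \<open>br n\<close> ignores the component along \<open>n\<close> and takes values orthogonal to
    it.\<close>
  have skew: "g (br n x) y + g x (br n y) = 0" for x y
  proof -
    have "g (br n x) y = g (br n x) (y - g n y *\<^sub>R n)"
      using n_orth[OF A_h[of x]] commute[of n] by simp
    moreover have "g x (br n y) = g (x - g n x *\<^sub>R n) (br n y)"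
      using n_orth[OF A_h[of y]] by simp
    ultimately show ?thesis using skew_h[OF split[of x] split[of y]] A_split by metis
  qed
  show ?thesis
  proof (rule flat_skew[OF g linear_A skew _ n_orth[OF A_h]])
    fix x y
    let ?x = "x - g n x *\<^sub>R n" and ?y = "y - g n y *\<^sub>R n"
    note s = bilinear_ladd[OF br_bil] bilinear_radd[OF br_bil] bilinear_lsub[OF br_bil]
      bilinear_rsub[OF br_bil] bilinear_lmul[OF br_bil] bilinear_rmul[OF br_bil]
    have "br x n + br n x = 0"
      using br_alt[of "x + n"]
      by (simp only: s br_alt[of x] br_alt[of n] add_0_left add_0_right add.commute)
    then have "br x n = - br n x" by (rule eq_neg_iff_add_eq_0[THEN iffD2])
    \<comment> \<open>Expanding this vanishing bracket of components in \<open>h\<close> expresses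
      \<open>br x y\<close> through \<open>br n\<close>.\<close>
    moreover have "br ?x ?y = 0" using abel split by blast
    ultimately show "br x y = g n x *\<^sub>R br n y - g n y *\<^sub>R br n x"
      by (simp add: s br_alt algebra_simps)
  qed
qed

theorem corollary7p9:
  fixes E :: "real^7 \<Rightarrow> real^7"
    and br :: "'v::real_vector \<Rightarrow> 'v \<Rightarrow> 'v"
    and \<Omega> :: "'v list \<Rightarrow> real"
    and g :: "'v \<Rightarrow> 'v \<Rightarrow> real"
  shows "(linear E \<and> (\<forall>x y. E x \<bullet> y = - (x \<bullet> E y)) \<longrightarrow> flat (ext_bracket E) (\<bullet>)) \<and>
         (dim (UNIV :: 'v set) = 8 \<and> quasi_abelian br \<and>
          spin7_structure \<Omega> g \<and> closed_form br 4 \<Omega> \<longrightarrow> flat br g)"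
  using flat_ext_bracket flat_spin7 by blast

end
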